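(* Let $S=\mathcal{M}(G;I,\Lambda;P)^1$ be a Rees matrix monoid over a group $G$. Then $S$ is a regular monoid such that for every finitely generated right congruence $\rho$ on $S$ and all $a,b,x,y\in S$ the right ideals $(aS)\rho\cap(bS)\rho$ and $(aS,x)\cap(bS,y)$ are finitely generated, and hence $S$ is right coherent. However, $S$ is weakly right noetherian if and only if $I$ is finite.
   Context: Let $G$ be a group, $I,\Lambda$ non-empty sets, and $P=(p_{\lambda i})$ a $\Lambda\times I$ matrix with entries in $G$. The Rees matrix semigroup $\mathcal{M}(G;I,\Lambda;P)$ is the set $I\times G\times\Lambda$ with multiplication $(i,a,\lambda)(j,b,\mu)=(i,ap_{\lambda j}b,\mu)$. The Rees matrix monoid $\mathcal{M}(G;I,\Lambda;P)^1$ is obtained from it by adjoining a new identity element $1$. A monoid $S$ is regular if for every $a\in S$ there is $b\in S$ with $a=aba$. A right ideal of $S$ is a subset $I'$ with $I'S\subseteq I'$ (the empty set is allowed, and is finitely generated); it is finitely generated if it is a finite union of sets $aS$ with $a\in I'$. $S$ is weakly right noetherian if every right ideal of $S$ is finitely generated. A right congruence on $S$ is an equivalence relation $\rho$ with $a\,\rho\,b\Rightarrow ac\,\rho\,bc$ for all $a,b,c\in S$; it is finitely generated if it is the smallest right congruence containing some finite subset of $S\times S$. For a right ideal $K$ of $S$, a right congruence $\rho$ and $x\in S$, write $K\rho=\{s\in S: s\,\rho\,a\text{ for some }a\in K\}$ and $(K,x)=\{t\in S: xt\in K\}$; both are right ideals. A right $S$-act is a set $A$ with a map $A\times S\to A$,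 $(a,s)\mapsto as$, with $a1=a$ and $a(st)=(as)t$. The free right $S$-act on a set $X$ is $F_S(X)=X\times S$ with $(x,s)t=(x,st)$. A congruence on a right $S$-act is an equivalence relation preserved by the action; it is finitely generated if it is the smallest congruence containing some finite set of pairs. An act $A$ is finitely generated if $A=a_1S\cup\dots\cup a_nS$ for some $a_i\in A$, and finitely presented if it is isomorphic to $F_S(X)/\rho$ with $X$ finite and $\rho$ a finitely generated congruence. The empty set is allowed as a subact (and is finitely generated). The monoid $S$ is right coherent if every finitely generated subact of every finitely presented right $S$-act is finitely presented. *)

theory Defs
  imports "HOL-Algebra.Coset"
begin

definition rees_carrier :: "('g, 'm) monoid_scheme \<Rightarrow> 'i set \<Rightarrow> 'l set \<Rightarrow> ('i \<times> 'g \<times> 'l) set"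
  where "rees_carrier G I \<Lambda> = I \<times> carrier G \<times> \<Lambda>"

fun rees_mult ::
  "('g, 'm) monoid_scheme \<Rightarrow> ('l \<Rightarrow> 'i \<Rightarrow> 'g) \<Rightarrow> 'i \<times> 'g \<times> 'l \<Rightarrow> 'i \<times> 'g \<times> 'l \<Rightarrow> 'i \<times> 'g \<times> 'l"
  where "rees_mult G P (i, a, l) (j, b, m) = (i, a \<otimes>\<^bsub>G\<^esub> P l j \<otimes>\<^bsub>G\<^esub> b, m)"

text \<open>A new identity, represented by \<^const>\<open>None\<close>, is adjoined unconditionally,
  even if the semigroup already has an identity.\<close>

fun adjoin_mult :: "('a \<Rightarrow> 'a \<Rightarrow> 'a) \<Rightarrow> 'a option \<Rightarrow> 'a option \<Rightarrow> 'a option"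
  where
    "adjoin_mult f None y = y"
  | "adjoin_mult f (Some x) None = Some x"
  | "adjoin_mult f (Some x) (Some y) = Some (f x y)"

definition adjoin_identity :: "'a set \<Rightarrow> ('a \<Rightarrow> 'a \<Rightarrow> 'a) \<Rightarrow> 'a option monoid"
  where "adjoin_identity A f =
    \<lparr>carrier = insert None (Some ` A), monoid.mult = adjoin_mult f, one = None\<rparr>"

definition rees_matrix_monoid ::
  "('g, 'm) monoid_scheme \<Rightarrow> 'i set \<Rightarrow> 'l set \<Rightarrow> ('l \<Rightarrow> 'i \<Rightarrow> 'g) \<Rightarrow> ('i \<times> 'g \<times> 'l) option monoid"
  where "rees_matrix_monoid G I \<Lambda> P = adjoin_identity (rees_carrier G I \<Lambda>) (rees_mult G P)"

definition regular_monoid :: "('s, 'm) monoid_scheme \<Rightarrow> bool"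
  where "regular_monoid S \<longleftrightarrow> Group.monoid S \<and>
    (\<forall>a\<in>carrier S. \<exists>b\<in>carrier S. a = a \<otimes>\<^bsub>S\<^esub> b \<otimes>\<^bsub>S\<^esub> a)"

definition right_ideal :: "('s, 'm) monoid_scheme \<Rightarrow> 's set \<Rightarrow> bool"
  where "right_ideal S K \<longleftrightarrow>
    K \<subseteq> carrier S \<and> (\<forall>k\<in>K. \<forall>s\<in>carrier S. k \<otimes>\<^bsub>S\<^esub> s \<in> K)"

definition fg_right_ideal :: "('s, 'm) monoid_scheme \<Rightarrow> 's set \<Rightarrow> bool"
  where "fg_right_ideal S K \<longleftrightarrow> right_ideal S K \<and>
    (\<exists>F. finite F \<and> F \<subseteq> K \<and> K = (\<Union>a\<in>F. a <#\<^bsub>S\<^esub> carrier S))"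

definition weakly_right_noetherian :: "('s, 'm) monoid_scheme \<Rightarrow> bool"
  where "weakly_right_noetherian S \<longleftrightarrow> (\<forall>K. right_ideal S K \<longrightarrow> fg_right_ideal S K)"

definition right_congruence :: "('s, 'm) monoid_scheme \<Rightarrow> ('s \<times> 's) set \<Rightarrow> bool"
  where "right_congruence S \<rho> \<longleftrightarrow> equiv (carrier S) \<rho> \<and>
    (\<forall>a b. (a, b) \<in> \<rho> \<longrightarrow> (\<forall>c\<in>carrier S. (a \<otimes>\<^bsub>S\<^esub> c, b \<otimes>\<^bsub>S\<^esub> c) \<in> \<rho>))"

definition fg_right_congruence :: "('s, 'm) monoid_scheme \<Rightarrow> ('s \<times> 's) set \<Rightarrow> bool"
  where "fg_right_congruence S \<rho> \<longleftrightarrow> right_congruence S \<rho> \<and>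
    (\<exists>H. finite H \<and> H \<subseteq> carrier S \<times> carrier S \<and> H \<subseteq> \<rho> \<and>
      (\<forall>\<sigma>. right_congruence S \<sigma> \<longrightarrow> H \<subseteq> \<sigma> \<longrightarrow> \<rho> \<subseteq> \<sigma>))"

text \<open>\<open>saturation S K \<rho>\<close> is \<open>K\<rho>\<close>, and \<open>residual S K x\<close> is \<open>(K, x)\<close>.\<close>

definition saturation :: "('s, 'm) monoid_scheme \<Rightarrow> 's set \<Rightarrow> ('s \<times> 's) set \<Rightarrow> 's set"
  where "saturation S K \<rho> = {s \<in> carrier S. \<exists>a\<in>K. (s, a) \<in> \<rho>}"

definition residual :: "('s, 'm) monoid_scheme \<Rightarrow> 's set \<Rightarrow> 's \<Rightarrow> 's set"
  where "residual S K x = {t \<in> carrier S. x \<otimes>\<^bsub>S\<^esub> t \<in> K}"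

record ('a, 's) ract = "'a partial_object" +
  act :: "'a \<Rightarrow> 's \<Rightarrow> 'a"

definition right_act :: "('s, 'm) monoid_scheme \<Rightarrow> ('a, 's) ract \<Rightarrow> bool"
  where "right_act S A \<longleftrightarrow>
    (\<forall>a\<in>carrier A. \<forall>s\<in>carrier S. act A a s \<in> carrier A) \<and>
    (\<forall>a\<in>carrier A. act A a \<one>\<^bsub>S\<^esub> = a) \<and>
    (\<forall>a\<in>carrier A. \<forall>s\<in>carrier S. \<forall>t\<in>carrier S. act A a (s \<otimes>\<^bsub>S\<^esub> t) = act A (act A a s) t)"

definition subact :: "('s, 'm) monoid_scheme \<Rightarrow> ('a, 's) ract \<Rightarrow> 'a set \<Rightarrow> bool"
  where "subact S A B \<longleftrightarrow>
    B \<subseteq> carrier A \<and> (\<forall>b\<in>B. \<forall>s\<in>carrier S. act A b s \<in> B)"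

definition fg_act :: "('s, 'm) monoid_scheme \<Rightarrow> ('a, 's) ract \<Rightarrow> bool"
  where "fg_act S A \<longleftrightarrow>
    (\<exists>F. finite F \<and> F \<subseteq> carrier A \<and> carrier A = (\<Union>a\<in>F. act A a ` carrier S))"

definition act_congruence :: "('s, 'm) monoid_scheme \<Rightarrow> ('a, 's) ract \<Rightarrow> ('a \<times> 'a) set \<Rightarrow> bool"
  where "act_congruence S A \<rho> \<longleftrightarrow> equiv (carrier A) \<rho> \<and>
    (\<forall>a b. (a, b) \<in> \<rho> \<longrightarrow> (\<forall>s\<in>carrier S. (act A a s, act A b s) \<in> \<rho>))"

definition fg_act_congruence :: "('s, 'm) monoid_scheme \<Rightarrow> ('a, 's) ract \<Rightarrow> ('a \<times> 'a) set \<Rightarrow> bool"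
  where "fg_act_congruence S A \<rho> \<longleftrightarrow> act_congruence S A \<rho> \<and>
    (\<exists>H. finite H \<and> H \<subseteq> carrier A \<times> carrier A \<and> H \<subseteq> \<rho> \<and>
      (\<forall>\<sigma>. act_congruence S A \<sigma> \<longrightarrow> H \<subseteq> \<sigma> \<longrightarrow> \<rho> \<subseteq> \<sigma>))"

definition free_act :: "('s, 'm) monoid_scheme \<Rightarrow> 'x set \<Rightarrow> ('x \<times> 's, 's) ract"
  where "free_act S X =
    \<lparr>carrier = X \<times> carrier S, act = (\<lambda>(x, s) t. (x, s \<otimes>\<^bsub>S\<^esub> t))\<rparr>"

text \<open>The union below is the single class of \<open>act A c s\<close>, for any representative \<open>c\<close>,
  whenever \<open>\<rho>\<close> is a congruence.\<close>

definition quotient_act :: "('a, 's) ract \<Rightarrow> ('a \<times> 'a) set \<Rightarrow> ('a set, 's) ract"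
  where "quotient_act A \<rho> =
    \<lparr>carrier = carrier A // \<rho>, act = (\<lambda>C s. \<Union>c\<in>C. \<rho> `` {act A c s})\<rparr>"

definition act_isomorphic ::
  "('s, 'm) monoid_scheme \<Rightarrow> ('a, 's) ract \<Rightarrow> ('b, 's) ract \<Rightarrow> bool"
  where "act_isomorphic S A B \<longleftrightarrow>
    (\<exists>f. bij_betw f (carrier A) (carrier B) \<and>
      (\<forall>a\<in>carrier A. \<forall>s\<in>carrier S. f (act A a s) = act B (f a) s))"

text \<open>Finite generating sets \<open>X\<close> are taken among the natural numbers; up to isomorphism of
  the free act, every finite set is of this form.\<close>

definition fp_act :: "('s, 'm) monoid_scheme \<Rightarrow> ('a, 's) ract \<Rightarrow> bool"
  where "fp_act S A \<longleftrightarrow>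
    (\<exists>(X :: nat set) \<rho>. finite X \<and> fg_act_congruence S (free_act S X) \<rho> \<and>
      act_isomorphic S A (quotient_act (free_act S X) \<rho>))"

text \<open>The type argument is the type of the elements of the acts considered. A statement in which
  \<open>'a\<close> is a type variable occurring nowhere else therefore covers all acts.\<close>

definition right_coherent :: "('s, 'm) monoid_scheme \<Rightarrow> 'a itself \<Rightarrow> bool"
  where "right_coherent S T \<longleftrightarrow>
    (\<forall>A :: ('a, 's) ract. right_act S A \<longrightarrow> fp_act S A \<longrightarrow>
      (\<forall>B. subact S A B \<longrightarrow> fg_act S (A\<lparr>carrier := B\<rparr>) \<longrightarrow> fp_act S (A\<lparr>carrier := B\<rparr>)))"

end

(* The right ideals of S other than S itself are the disjoint unions of the minimal right ideals
   R_i = {i} x G x Lambda, so a right ideal is finitely generated iff it contains 1 or meets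
   finitely many R_i.  Saturating by a finitely generated congruence either absorbs 1 or adds only
   indices occurring in the generators.

   For coherence, let q map a finitely generated free act X x S onto A with finitely generated
   kernel, and let B be a finitely generated subact of A.  Each K_x = {s. q (x, s) in B} is
   finitely generated by the argument above, hence a finite disjoint union of ideals e S with e
   idempotent, and e S is presented by the single relation 1 = e.  So q^-1(B) is finitely
   presented, and the kernel of q restricted to it is generated by the pairs (a d, a' d), for (a, a')
   a generating pair of the kernel and d a generator of the finitely generated right ideal of
   those t with a t in q^-1(B). *)

theory Submission
  imports Defs
begin

section \<open>Presentations as surjective morphisms from free acts\<close>

section \<open>Presentations of acts\<close>

text \<open>A surjective act morphism from the free act on \<open>X\<close> onto \<open>A\<close>.
  Presentations are handled through such morphisms and their kernels, which avoids computing with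
  classes of a quotient act.\<close>

definition covering :: "('s, 'm) monoid_scheme \<Rightarrow> ('a, 's) ract \<Rightarrow> 'x set \<Rightarrow> ('x \<times> 's \<Rightarrow> 'a) \<Rightarrow> bool"
  where "covering S A X q \<longleftrightarrow> q ` (X \<times> carrier S) = carrier A \<and>
    (\<forall>x\<in>X. \<forall>s\<in>carrier S. \<forall>t\<in>carrier S. q (x, s \<otimes>\<^bsub>S\<^esub> t) = act A (q (x, s)) t)"

text \<open>The restriction to \<open>X \<times> carrier S\<close> matters: \<open>q\<close> is
  total on its type, and its values off the free act are arbitrary.\<close>

definition act_kernel :: "('s, 'm) monoid_scheme \<Rightarrow> 'x set \<Rightarrow> ('x \<times> 's \<Rightarrow> 'a) \<Rightarrow> (('x \<times> 's) \<times> ('x \<times> 's)) set"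
  where "act_kernel S X q = {(u, v). u \<in> X \<times> carrier S \<and> v \<in> X \<times> carrier S \<and> q u = q v}"

lemma free_act_simps [simp]:
  "carrier (free_act S X) = X \<times> carrier S"
  "act (free_act S X) (x, s) t = (x, s \<otimes>\<^bsub>S\<^esub> t)"
  by (simp_all add: free_act_def)

lemma act_congruence_iff:
  "act_congruence S A \<rho> \<longleftrightarrow> \<rho> \<subseteq> carrier A \<times> carrier A \<and> (\<forall>a\<in>carrier A. (a, a) \<in> \<rho>) \<and>
    (\<forall>a b. (a, b) \<in> \<rho> \<longrightarrow> (b, a) \<in> \<rho>) \<and>
    (\<forall>a b c. (a, b) \<in> \<rho> \<longrightarrow> (b, c) \<in> \<rho> \<longrightarrow> (a, c) \<in> \<rho>) \<and>
    (\<forall>a b. (a, b) \<in> \<rho> \<longrightarrow> (\<forall>s\<in>carrier S. (act A a s, act A b s) \<in> \<rho>))"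
  unfolding act_congruence_def equiv_def refl_on_def sym_def trans_def by blast

lemma act_congruence_kernel:
  assumes "monoid S" "covering S A X q"
  shows "act_congruence S (free_act S X) (act_kernel S X q)"
proof -
  interpret monoid S by fact
  show ?thesis
    using assms(2) unfolding act_congruence_iff act_kernel_def covering_def by auto
qed

text \<open>This is the first isomorphism theorem: the kernel classes are the fibres of
  \<open>q\<close>, and an element of \<open>A\<close> is sent to its fibre.\<close>

lemma fp_act_if_covering:
  fixes X :: "nat set"
  assumes mon: "monoid S" and fin: "finite X" and cov: "covering S A X q"
    and fg: "fg_act_congruence S (free_act S X) (act_kernel S X q)"
  shows "fp_act S A"
proof -
  interpret monoid S by fact
  let ?F = "free_act S X" and ?k = "act_kernel S X q"
  have cong: "act_congruence S ?F ?k" by (rule act_congruence_kernel[OF mon cov])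
  then have eq: "equiv (X \<times> carrier S) ?k" by (simp add: act_congruence_def)
  define f where "f a = {u \<in> X \<times> carrier S. q u = a}" for a
  have f_q: "f (q u) = ?k `` {u}" if "u \<in> X \<times> carrier S" for u
    using that by (auto simp: f_def act_kernel_def)
  have im: "q ` (X \<times> carrier S) = carrier A"
    using cov by (simp add: covering_def)
  have bij: "bij_betw f (carrier A) (carrier (quotient_act ?F ?k))"
  proof (rule bij_betw_imageI)
    show "inj_on f (carrier A)"
    proof (rule inj_onI)
      fix a b assume "a \<in> carrier A" "b \<in> carrier A" and ab: "f a = f b"
      then obtain u where u: "u \<in> X \<times> carrier S" "a = q u" using im by blast
      then have "u \<in> f b" using ab by (auto simp: f_def)
      then show "a = b" using u by (simp add: f_def)
    qed
    have "f ` carrier A = (\<lambda>u. ?k `` {u}) ` (X \<times> carrier S)"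
      unfolding im[symmetric] image_image by (rule image_cong) (simp_all add: f_q)
    then show "f ` carrier A = carrier (quotient_act ?F ?k)"
      by (auto simp: quotient_act_def quotient_def)
  qed
  have "f (act A a s) = act (quotient_act ?F ?k) (f a) s" if a: "a \<in> carrier A" and s: "s \<in> carrier S" for a s
  proof -
    obtain x r where u: "x \<in> X" "r \<in> carrier S" "a = q (x, r)" using a im by blast
    \<comment> \<open>All members of the fibre \<open>f a\<close> give the same class after acting
      by \<open>s\<close>, so the union that defines the quotient action collapses to that
      class.\<close>
    have *: "?k `` {act ?F c s} = ?k `` {(x, r \<otimes>\<^bsub>S\<^esub> s)}" if "c \<in> f a" for c
    proof -
      have "(c, (x, r)) \<in> ?k" using that u by (auto simp: f_def act_kernel_def)
      then have "(act ?F c s, act ?F (x, r) s) \<in> ?k"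
        using cong s unfolding act_congruence_def by blast
      then show ?thesis using equiv_class_eq[OF eq] by simp
    qed
    have "(x, r) \<in> f a" using u by (simp add: f_def)
    then have "act (quotient_act ?F ?k) (f a) s = ?k `` {(x, r \<otimes>\<^bsub>S\<^esub> s)}"
      using * by (auto simp: quotient_act_def)
    also have "\<dots> = f (q (x, r \<otimes>\<^bsub>S\<^esub> s))" using u s by (simp add: f_q)
    also have "q (x, r \<otimes>\<^bsub>S\<^esub> s) = act A a s" using cov u s by (simp add: covering_def)
    finally show ?thesis by simp
  qed
  then have "act_isomorphic S A (quotient_act ?F ?k)"
    unfolding act_isomorphic_def using bij by blast
  then show ?thesis unfolding fp_act_def using fin fg by blast
qed

text \<open>The morphism is the projection to the quotient followed by the inverse of the given
  isomorphism. That \<open>A\<close> is an act ensures that \<open>act A (q (x, s)) t\<close> stays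
  in the carrier, where \<open>f\<close> is injective, so equivariance can be tested after applying
  \<open>f\<close>.\<close>

lemma fp_act_obtains_covering:
  assumes mon: "monoid S" and act: "right_act S A" and fp: "fp_act S A"
  obtains X :: "nat set" and q where "finite X" "covering S A X q"
    "fg_act_congruence S (free_act S X) (act_kernel S X q)"
proof -
  interpret monoid S by fact
  obtain X :: "nat set" and \<rho> f where fin: "finite X"
    and fg: "fg_act_congruence S (free_act S X) \<rho>"
    and bij: "bij_betw f (carrier A) (carrier (quotient_act (free_act S X) \<rho>))"
    and hom: "\<And>a s. a \<in> carrier A \<Longrightarrow> s \<in> carrier S \<Longrightarrow>
      f (act A a s) = act (quotient_act (free_act S X) \<rho>) (f a) s"
    using fp unfolding fp_act_def act_isomorphic_def by blast
  let ?F = "free_act S X"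
  have cong: "act_congruence S ?F \<rho>" using fg by (simp add: fg_act_congruence_def)
  then have eq: "equiv (X \<times> carrier S) \<rho>" by (simp add: act_congruence_def)
  have car: "carrier (quotient_act ?F \<rho>) = (\<lambda>u. \<rho> `` {u}) ` (X \<times> carrier S)"
    by (auto simp: quotient_act_def quotient_def)
  define q where "q u = inv_into (carrier A) f (\<rho> `` {u})" for u
  have fq: "f (q u) = \<rho> `` {u}" if "u \<in> X \<times> carrier S" for u
    unfolding q_def using that bij_betw_inv_into_right[OF bij] car by blast
  have qA: "q ` (X \<times> carrier S) = carrier A"
    using bij_betw_imp_surj_on[OF bij_betw_inv_into[OF bij]] unfolding car q_def
    by (simp add: image_image)
  have "q (x, s \<otimes>\<^bsub>S\<^esub> t) = act A (q (x, s)) t"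
    if x: "x \<in> X" and s: "s \<in> carrier S" and t: "t \<in> carrier S" for x s t
  proof -
    have m: "q (x, s) \<in> carrier A" using qA x s by blast
    have *: "\<rho> `` {act ?F c t} = \<rho> `` {(x, s \<otimes>\<^bsub>S\<^esub> t)}" if "c \<in> \<rho> `` {(x, s)}" for c
    proof -
      have "(act ?F (x, s) t, act ?F c t) \<in> \<rho>"
        using that cong t unfolding act_congruence_def by blast
      then show ?thesis using equiv_class_eq[OF eq] by simp
    qed
    have "(x, s) \<in> \<rho> `` {(x, s)}" using equiv_class_self[OF eq] x s by simp
    then have "f (act A (q (x, s)) t) = \<rho> `` {(x, s \<otimes>\<^bsub>S\<^esub> t)}"
      using * by (auto simp: hom[OF m t] fq x s quotient_act_def)
    also have "\<dots> = f (q (x, s \<otimes>\<^bsub>S\<^esub> t))" using x s t by (simp add: fq)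
    finally have "f (q (x, s \<otimes>\<^bsub>S\<^esub> t)) = f (act A (q (x, s)) t)" by simp
    moreover have "q (x, s \<otimes>\<^bsub>S\<^esub> t) \<in> carrier A" using qA x s t by blast
    moreover have "act A (q (x, s)) t \<in> carrier A" using act m t by (simp add: right_act_def)
    ultimately show ?thesis using bij by (meson bij_betw_imp_inj_on inj_onD)
  qed
  with qA have cov: "covering S A X q" by (simp add: covering_def)
  have "(u, v) \<in> \<rho> \<longleftrightarrow> q u = q v" if "u \<in> X \<times> carrier S" "v \<in> X \<times> carrier S" for u v
    using eq_equiv_class_iff[OF eq that] fq that unfolding q_def by metis
  then have "act_kernel S X q = \<rho>"
    using equiv_type[OF eq] by (auto simp: act_kernel_def)
  with fin fg cov that show thesis by blast
qed

section \<open>Presenting a subact whose preimage splits into ideals generated by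
  idempotents\<close>

text \<open>By \<open>unique\<close>, each \<open>K x\<close> is the disjoint union of the ideals eS
  with e in \<open>E x\<close>, so an element of the preimage of \<open>B\<close> determines the
  summand containing it. One generator is taken per summand. The hypothesis \<open>res\<close>
  ensures that finitely many translates of each generating pair of the kernel suffice as
  relations.\<close>

lemma fp_subact_if_idempotent_generated:
  fixes S :: "('s, 'm) monoid_scheme" and X :: "'x set" and A :: "('a, 's) ract" and E K :: "'x \<Rightarrow> 's set"
  assumes mon: "monoid S" and finX: "finite X" and cov: "covering S A X q"
    and fg: "fg_act_congruence S (free_act S X) (act_kernel S X q)"
    and act: "right_act S A" and sub: "subact S A B"
    and K: "\<And>x. K x = {s \<in> carrier S. q (x, s) \<in> B}"
    and finE: "\<And>x. x \<in> X \<Longrightarrow> finite (E x)"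
    and EK: "\<And>x. x \<in> X \<Longrightarrow> E x \<subseteq> K x"
    and idem: "\<And>x e. x \<in> X \<Longrightarrow> e \<in> E x \<Longrightarrow> e \<otimes>\<^bsub>S\<^esub> e = e"
    and unique: "\<And>x u. x \<in> X \<Longrightarrow> u \<in> K x \<Longrightarrow> \<exists>!e. e \<in> E x \<and> e \<otimes>\<^bsub>S\<^esub> u = u"
    and res: "\<And>x a. x \<in> X \<Longrightarrow> a \<in> carrier S \<Longrightarrow> fg_right_ideal S (residual S (K x) a)"
  shows "fp_act S (A\<lparr>carrier := B\<rparr>)"
proof -
  interpret monoid S by fact
  have KS: "u \<in> carrier S" if "u \<in> K x" for x u using that by (simp add: K)
  have hom: "q (x, s \<otimes>\<^bsub>S\<^esub> t) = act A (q (x, s)) t"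
    if "x \<in> X" "s \<in> carrier S" "t \<in> carrier S" for x s t
    using cov that by (simp add: covering_def)
  have Kideal: "u \<otimes>\<^bsub>S\<^esub> t \<in> K x" if "x \<in> X" "u \<in> K x" "t \<in> carrier S" for x u t
    using that sub by (auto simp: K hom subact_def)
  obtain H where finH: "finite H" and Hker: "H \<subseteq> act_kernel S X q"
    and Hmin: "\<And>\<sigma>. act_congruence S (free_act S X) \<sigma> \<Longrightarrow> H \<subseteq> \<sigma> \<Longrightarrow> act_kernel S X q \<subseteq> \<sigma>"
    using fg unfolding fg_act_congruence_def by blast
  \<comment> \<open>The pairs (x, e) are numbered because \<open>fp_act\<close> asks for generators
    among the natural numbers.\<close>
  have "finite (SIGMA x:X. E x)" using finX finE by blast
  then obtain h :: "nat \<Rightarrow> 'x \<times> 's" and n where h: "bij_betw h {..<n} (SIGMA x:X. E x)"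
    using ex_bij_betw_nat_finite atLeast0LessThan by metis
  define g where "g = inv_into {..<n} h"
  have hg: "h (g p) = p" "g p < n" if "p \<in> (SIGMA x:X. E x)" for p
    using that h bij_betw_inv_into_right[OF h] bij_betw_apply[OF bij_betw_inv_into[OF h]]
    unfolding g_def by auto
  have gh: "g (h y) = y" "h y \<in> (SIGMA x:X. E x)" if "y < n" for y
    using that bij_betw_inv_into_left[OF h] bij_betw_apply[OF h] unfolding g_def by auto
  define e where "e x u = (THE e. e \<in> E x \<and> e \<otimes>\<^bsub>S\<^esub> u = u)" for x u
  have e: "e x u \<in> E x" "e x u \<otimes>\<^bsub>S\<^esub> u = u" if "x \<in> X" "u \<in> K x" for x u
    using theI'[OF unique[OF that]] unfolding e_def by auto
  have e_eq: "e x u = d" if "x \<in> X" "u \<in> K x" "d \<in> E x" "d \<otimes>\<^bsub>S\<^esub> u = u" for x u d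
    using unique[OF that(1,2)] e[OF that(1,2)] that(3,4) by blast
  have ES: "d \<in> carrier S" if "x \<in> X" "d \<in> E x" for x d
    using that EK KS by blast
  \<comment> \<open>An idempotent that fixes \<open>u\<close> on the left also fixes
    \<open>u\<close> times \<open>t\<close>, so by uniqueness it is the one chosen for the product.
    This makes \<open>j\<close> below equivariant.\<close>
  have e_mult: "e x (u \<otimes>\<^bsub>S\<^esub> t) = e x u" if x: "x \<in> X" and u: "u \<in> K x" and t: "t \<in> carrier S" for x u t
  proof (rule e_eq[OF x Kideal[OF x u t]])
    show "e x u \<otimes>\<^bsub>S\<^esub> (u \<otimes>\<^bsub>S\<^esub> t) = u \<otimes>\<^bsub>S\<^esub> t"
      using e[OF x u] ES[OF x e(1)[OF x u]] KS[OF u] t by (simp flip: m_assoc)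
  qed (rule e(1)[OF x u])
  let ?Y = "{..<n}"
  \<comment> \<open>The generator numbered by (x, e) is sent to \<open>q (x, e)\<close>.\<close>
  define \<phi> where "\<phi> w = q (fst (h (fst w)), snd (h (fst w)) \<otimes>\<^bsub>S\<^esub> snd w)" for w
  \<comment> \<open>A morphism from the preimage of \<open>B\<close> to the free act on \<open>?Y\<close> that splits the projection
    up to the relations \<open>1 = e\<close>.\<close>
  define j where "j w = (g (fst w, e (fst w) (snd w)), snd w)" for w
  have h_obtain: "\<exists>x\<in>X. \<exists>d\<in>E x. h y = (x, d)" if "y < n" for y
    using gh(2)[OF that] by auto
  have jF: "j (x, u) \<in> ?Y \<times> carrier S" if "x \<in> X" "u \<in> K x" for x u
    using that hg e KS by (auto simp: j_def)
  have j_mult: "j (x, u \<otimes>\<^bsub>S\<^esub> t) = act (free_act S ?Y) (j (x, u)) t"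
    if "x \<in> X" "u \<in> K x" "t \<in> carrier S" for x u t
    using that by (simp add: j_def e_mult)
  have \<phi>j: "\<phi> (j (x, u)) = q (x, u)" if "x \<in> X" "u \<in> K x" for x u
    using that by (simp add: j_def \<phi>_def hg e)
  have cov': "covering S (A\<lparr>carrier := B\<rparr>) ?Y \<phi>"
    unfolding covering_def
  proof (intro conjI ballI)
    show "\<phi> ` (?Y \<times> carrier S) = carrier (A\<lparr>carrier := B\<rparr>)"
    proof
      show "\<phi> ` (?Y \<times> carrier S) \<subseteq> carrier (A\<lparr>carrier := B\<rparr>)"
      proof clarify
        fix y s assume "y < n" and s: "s \<in> carrier S"
        then obtain x d where "x \<in> X" "d \<in> E x" "h y = (x, d)" using h_obtain by blast
        then have "d \<otimes>\<^bsub>S\<^esub> s \<in> K x" using Kideal EK s by blast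
        then show "\<phi> (y, s) \<in> carrier (A\<lparr>carrier := B\<rparr>)"
          using \<open>h y = (x, d)\<close> by (simp add: \<phi>_def K)
      qed
      show "carrier (A\<lparr>carrier := B\<rparr>) \<subseteq> \<phi> ` (?Y \<times> carrier S)"
      proof
        fix b assume "b \<in> carrier (A\<lparr>carrier := B\<rparr>)"
        then have b: "b \<in> B" by simp
        then have "b \<in> carrier A" using sub by (auto simp: subact_def)
        then obtain x s where xs: "x \<in> X" "s \<in> carrier S" "b = q (x, s)"
          using cov unfolding covering_def by blast
        then have "s \<in> K x" using b by (simp add: K)
        then show "b \<in> \<phi> ` (?Y \<times> carrier S)" using xs \<phi>j jF by (metis image_eqI)
      qed
    qed
  next
    fix y s t assume "y \<in> ?Y" and st: "s \<in> carrier S" "t \<in> carrier S"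
    then obtain x d where xd: "x \<in> X" "d \<in> E x" "h y = (x, d)" using h_obtain by blast
    then have "d \<in> carrier S" using ES by blast
    with xd st show "\<phi> (y, s \<otimes>\<^bsub>S\<^esub> t) = act (A\<lparr>carrier := B\<rparr>) (\<phi> (y, s)) t"
      by (simp add: \<phi>_def hom flip: m_assoc)
  qed
  have "\<exists>D. finite D \<and> D \<subseteq> residual S (K x) a \<and>
      residual S (K x) a = (\<Union>d\<in>D. d <#\<^bsub>S\<^esub> carrier S)" if "x \<in> X" "a \<in> carrier S" for x a
    using res[OF that] by (auto simp: fg_right_ideal_def)
  then obtain D where D: "\<And>x a. x \<in> X \<Longrightarrow> a \<in> carrier S \<Longrightarrow> finite (D x a) \<and>
      D x a \<subseteq> residual S (K x) a \<and> residual S (K x) a = (\<Union>d\<in>D x a. d <#\<^bsub>S\<^esub> carrier S)"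
    by metis
  \<comment> \<open>The first family consists of the relations 1 = e. The second carries over, along
    \<open>j\<close>, the translates of pairs in \<open>H\<close> by the generators
    \<open>D x a\<close> of the set of multipliers that bring the left member into the preimage of
    \<open>B\<close>.\<close>
  define H' where "H' = (\<lambda>y. ((y, \<one>\<^bsub>S\<^esub>), (y, snd (h y)))) ` ?Y \<union>
    (\<Union>((x, a), (x', a'))\<in>H. (\<lambda>d. (j (x, a \<otimes>\<^bsub>S\<^esub> d), j (x', a' \<otimes>\<^bsub>S\<^esub> d))) ` D x a)"
  have Hrel: "x \<in> X \<and> a \<in> carrier S \<and> x' \<in> X \<and> a' \<in> carrier S \<and> q (x, a) = q (x', a')"
    if "((x, a), (x', a')) \<in> H" for x a x' a'
    using that Hker by (auto simp: act_kernel_def)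
  \<comment> \<open>Membership in the preimage of \<open>B\<close> depends only on the value of
    \<open>q\<close>. Hence the two members of a kernel pair have the same residual, and
    \<open>D x a\<close> serves both.\<close>
  have saturated: "a' \<otimes>\<^bsub>S\<^esub> t \<in> K x' \<longleftrightarrow> a \<otimes>\<^bsub>S\<^esub> t \<in> K x"
    if "((x, a), (x', a')) \<in> act_kernel S X q" "t \<in> carrier S" for x a x' a' t
    using that by (auto simp: act_kernel_def K hom)
  have finH': "finite H'"
    unfolding H'_def using finH D by (auto dest!: Hrel)
  have H'ker: "H' \<subseteq> act_kernel S ?Y \<phi>"
  proof -
    have "((y, \<one>\<^bsub>S\<^esub>), (y, snd (h y))) \<in> act_kernel S ?Y \<phi>" if "y < n" for y
    proof -
      obtain x d where "x \<in> X" "d \<in> E x" "h y = (x, d)" using h_obtain[OF \<open>y < n\<close>] by blast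
      then show ?thesis using that ES idem by (simp add: act_kernel_def \<phi>_def)
    qed
    moreover have "(j (x, a \<otimes>\<^bsub>S\<^esub> d), j (x', a' \<otimes>\<^bsub>S\<^esub> d)) \<in> act_kernel S ?Y \<phi>"
      if "((x, a), (x', a')) \<in> H" "d \<in> D x a" for x a x' a' d
    proof -
      note r = Hrel[OF that(1)]
      then have d: "d \<in> carrier S" "a \<otimes>\<^bsub>S\<^esub> d \<in> K x" using D that(2) by (auto simp: residual_def)
      then have "a' \<otimes>\<^bsub>S\<^esub> d \<in> K x'" using saturated that(1) Hker by blast
      moreover have "q (x, a \<otimes>\<^bsub>S\<^esub> d) = q (x', a' \<otimes>\<^bsub>S\<^esub> d)" using r d by (simp add: hom)
      ultimately show ?thesis
        using r d jF \<phi>j unfolding act_kernel_def by simp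
    qed
    ultimately show ?thesis unfolding H'_def by auto
  qed
  have min: "act_kernel S ?Y \<phi> \<subseteq> \<sigma>"
    if \<sigma>: "act_congruence S (free_act S ?Y) \<sigma>" and H': "H' \<subseteq> \<sigma>" for \<sigma>
  proof -
    have \<sigma>refl: "\<And>w. w \<in> ?Y \<times> carrier S \<Longrightarrow> (w, w) \<in> \<sigma>"
      and \<sigma>sym: "\<And>u v. (u, v) \<in> \<sigma> \<Longrightarrow> (v, u) \<in> \<sigma>"
      and \<sigma>trans: "\<And>u v w. (u, v) \<in> \<sigma> \<Longrightarrow> (v, w) \<in> \<sigma> \<Longrightarrow> (u, w) \<in> \<sigma>"
      and \<sigma>act: "\<And>u v s. (u, v) \<in> \<sigma> \<Longrightarrow> s \<in> carrier S \<Longrightarrow>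
        (act (free_act S ?Y) u s, act (free_act S ?Y) v s) \<in> \<sigma>"
      using \<sigma> unfolding act_congruence_iff free_act_simps(1) by blast+
    \<comment> \<open>Minimality of the kernel concerns congruences on the free act on
      \<open>X\<close>, whereas \<open>\<sigma>\<close> lives over \<open>?Y\<close>. So
      \<open>\<sigma>\<close> is pulled back along \<open>j\<close>, with a condition only on
      translates inside the preimage of \<open>B\<close>, where \<open>j\<close> is meaningful.
      Quantifying over \<open>t\<close> gives closure under the action; symmetry and transitivity
      rest on \<open>saturated\<close>.\<close>
    define \<tau> where "\<tau> = {((x, a), (x', a')). ((x, a), (x', a')) \<in> act_kernel S X q \<and>
      (\<forall>t\<in>carrier S. a \<otimes>\<^bsub>S\<^esub> t \<in> K x \<longrightarrow> (j (x, a \<otimes>\<^bsub>S\<^esub> t), j (x', a' \<otimes>\<^bsub>S\<^esub> t)) \<in> \<sigma>)}"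
    have ker: "act_congruence S (free_act S X) (act_kernel S X q)"
      using act_congruence_kernel[OF mon cov] .
    have "act_congruence S (free_act S X) \<tau>"
      unfolding act_congruence_iff
    proof (intro conjI allI impI ballI)
      show "\<tau> \<subseteq> carrier (free_act S X) \<times> carrier (free_act S X)"
        by (auto simp: \<tau>_def act_kernel_def)
      show "(w, w) \<in> \<tau>" if "w \<in> carrier (free_act S X)" for w
        using that \<sigma>refl[OF jF] by (auto simp: \<tau>_def act_kernel_def)
      show "(v, u) \<in> \<tau>" if uv: "(u, v) \<in> \<tau>" for u v
      proof -
        obtain x a where u: "u = (x, a)" by fastforce
        obtain x' a' where v: "v = (x', a')" by fastforce
        have k: "((x, a), (x', a')) \<in> act_kernel S X q" using uv u v by (simp add: \<tau>_def)
        then have "((x', a'), (x, a)) \<in> act_kernel S X q" by (simp add: act_kernel_def)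
        then show ?thesis
          using uv \<sigma>sym saturated[OF k] unfolding u v \<tau>_def by blast
      qed
      show "(u, w) \<in> \<tau>" if uv: "(u, v) \<in> \<tau>" and vw: "(v, w) \<in> \<tau>" for u v w
      proof -
        obtain x a where u: "u = (x, a)" by fastforce
        obtain x' a' where v: "v = (x', a')" by fastforce
        obtain y b where w: "w = (y, b)" by fastforce
        have "(u, v) \<in> act_kernel S X q" "(v, w) \<in> act_kernel S X q"
          using uv vw by (auto simp: \<tau>_def)
        then have "(u, w) \<in> act_kernel S X q" by (auto simp: act_kernel_def)
        moreover have "(j (x, a \<otimes>\<^bsub>S\<^esub> t), j (y, b \<otimes>\<^bsub>S\<^esub> t)) \<in> \<sigma>"
          if t: "t \<in> carrier S" "a \<otimes>\<^bsub>S\<^esub> t \<in> K x" for t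
        proof -
          have "a' \<otimes>\<^bsub>S\<^esub> t \<in> K x'"
            using saturated \<open>(u, v) \<in> act_kernel S X q\<close> t unfolding u v by blast
          then show ?thesis using uv vw t \<sigma>trans unfolding u v w \<tau>_def by blast
        qed
        ultimately show ?thesis unfolding u w \<tau>_def by blast
      qed
      show "(act (free_act S X) u s, act (free_act S X) v s) \<in> \<tau>"
        if uv: "(u, v) \<in> \<tau>" and s: "s \<in> carrier S" for u v s
      proof -
        obtain x a where u: "u = (x, a)" by fastforce
        obtain x' a' where v: "v = (x', a')" by fastforce
        have k: "(u, v) \<in> act_kernel S X q" using uv by (auto simp: \<tau>_def)
        then have "(act (free_act S X) u s, act (free_act S X) v s) \<in> act_kernel S X q"
          using ker s unfolding act_congruence_def by blast
        moreover have "a \<in> carrier S" "a' \<in> carrier S" using k by (auto simp: u v act_kernel_def)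
        ultimately show ?thesis using uv s by (simp add: u v \<tau>_def m_assoc)
      qed
    qed
    moreover have "H \<subseteq> \<tau>"
    proof clarify
      fix x a x' a' assume H: "((x, a), (x', a')) \<in> H"
      note r = Hrel[OF H]
      have "(j (x, a \<otimes>\<^bsub>S\<^esub> t), j (x', a' \<otimes>\<^bsub>S\<^esub> t)) \<in> \<sigma>"
        if t: "t \<in> carrier S" "a \<otimes>\<^bsub>S\<^esub> t \<in> K x" for t
      proof -
        \<comment> \<open>Every relevant \<open>t\<close> factors through some \<open>d\<close> in
          \<open>D x a\<close>; the relation for \<open>d\<close> lies in \<open>H'\<close>, and
          acting on it by \<open>s\<close> gives the one for \<open>t\<close>.\<close>
        have "t \<in> residual S (K x) a" using t by (simp add: residual_def)
        then obtain d s where d: "d \<in> D x a" and s: "s \<in> carrier S" "t = d \<otimes>\<^bsub>S\<^esub> s"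
          using D r by (auto simp: l_coset_def)
        have dS: "d \<in> carrier S" "a \<otimes>\<^bsub>S\<^esub> d \<in> K x" using D d r by (auto simp: residual_def)
        then have "a' \<otimes>\<^bsub>S\<^esub> d \<in> K x'" using saturated H Hker by blast
        moreover have "(j (x, a \<otimes>\<^bsub>S\<^esub> d), j (x', a' \<otimes>\<^bsub>S\<^esub> d)) \<in> \<sigma>"
        proof (rule subsetD[OF H'])
          show "(j (x, a \<otimes>\<^bsub>S\<^esub> d), j (x', a' \<otimes>\<^bsub>S\<^esub> d)) \<in> H'"
            unfolding H'_def by (rule UnI2, rule UN_I[OF H]) (use d in simp)
        qed
        ultimately show ?thesis
          using \<sigma>act[of "j (x, a \<otimes>\<^bsub>S\<^esub> d)" "j (x', a' \<otimes>\<^bsub>S\<^esub> d)" s] r dS s j_mult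
          by (simp flip: m_assoc)
      qed
      then show "((x, a), (x', a')) \<in> \<tau>" using H Hker by (auto simp: \<tau>_def)
    qed
    ultimately have \<tau>: "act_kernel S X q \<subseteq> \<tau>" by (rule Hmin)
    \<comment> \<open>Acting by \<open>s\<close> on the relation 1 = d links (y, s) to the image
      under \<open>j\<close> of an element of the preimage of \<open>B\<close>; these images serve
      as normal forms.\<close>
    have norm: "((y, s), j (x, d \<otimes>\<^bsub>S\<^esub> s)) \<in> \<sigma>" "d \<otimes>\<^bsub>S\<^esub> s \<in> K x"
      if y: "y < n" and s: "s \<in> carrier S" and xd: "h y = (x, d)" for y s x d
    proof -
      have x: "x \<in> X" and d: "d \<in> E x" using gh(2)[OF y] xd by auto
      have "d \<in> K x" using d x EK by blast
      then show ds: "d \<otimes>\<^bsub>S\<^esub> s \<in> K x" using Kideal x s by blast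
      have dS: "d \<in> carrier S" using ES[OF x d] .
      have "d \<otimes>\<^bsub>S\<^esub> (d \<otimes>\<^bsub>S\<^esub> s) = d \<otimes>\<^bsub>S\<^esub> s" using idem[OF x d] dS s by (simp flip: m_assoc)
      then have "e x (d \<otimes>\<^bsub>S\<^esub> s) = d" using e_eq[OF x ds d] by simp
      then have "j (x, d \<otimes>\<^bsub>S\<^esub> s) = (y, d \<otimes>\<^bsub>S\<^esub> s)" using gh(1)[OF y] xd by (simp add: j_def)
      moreover have "((y, \<one>\<^bsub>S\<^esub>), (y, d)) \<in> \<sigma>"
      proof (rule subsetD[OF H'])
        show "((y, \<one>\<^bsub>S\<^esub>), (y, d)) \<in> H'"
          unfolding H'_def by (rule UnI1, rule image_eqI[of _ _ y]) (simp_all add: xd y)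
      qed
      ultimately show "((y, s), j (x, d \<otimes>\<^bsub>S\<^esub> s)) \<in> \<sigma>"
        using \<sigma>act[of "(y, \<one>\<^bsub>S\<^esub>)" "(y, d)" s] s by simp
    qed
    show ?thesis
    proof clarify
      fix y s y' s' assume k: "((y, s), (y', s')) \<in> act_kernel S ?Y \<phi>"
      obtain x d where xd: "h y = (x, d)" by fastforce
      obtain x' d' where xd': "h y' = (x', d')" by fastforce
      have yy: "y < n" "y' < n" "s \<in> carrier S" "s' \<in> carrier S"
        using k by (auto simp: act_kernel_def)
      note norm1 = norm[OF yy(1,3) xd] and norm2 = norm[OF yy(2,4) xd']
      have "x \<in> X" "x' \<in> X" using gh(2)[OF yy(1)] gh(2)[OF yy(2)] xd xd' by auto
      then have "((x, d \<otimes>\<^bsub>S\<^esub> s), (x', d' \<otimes>\<^bsub>S\<^esub> s')) \<in> act_kernel S X q"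
        using k norm1(2) norm2(2) KS xd xd' by (auto simp: act_kernel_def \<phi>_def)
      then have "((x, d \<otimes>\<^bsub>S\<^esub> s), (x', d' \<otimes>\<^bsub>S\<^esub> s')) \<in> \<tau>" using \<tau> by blast
      \<comment> \<open>The condition in \<open>\<tau>\<close> at \<open>t\<close> = 1 relates the
        two normal forms themselves.\<close>
      then have "(j (x, d \<otimes>\<^bsub>S\<^esub> s), j (x', d' \<otimes>\<^bsub>S\<^esub> s')) \<in> \<sigma>"
        using KS[OF norm1(2)] KS[OF norm2(2)] norm1(2) unfolding \<tau>_def
        by (auto dest: bspec[OF _ one_closed])
      then show "((y, s), (y', s')) \<in> \<sigma>"
        using \<sigma>trans[OF norm1(1)] \<sigma>trans \<sigma>sym[OF norm2(1)] by blast
    qed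
  qed
  have "fg_act_congruence S (free_act S ?Y) (act_kernel S ?Y \<phi>)"
    unfolding fg_act_congruence_def
    using act_congruence_kernel[OF mon cov'] finH' H'ker min
    by (intro conjI exI[of _ H']) (auto simp: act_kernel_def)
  with mon cov' show ?thesis by (intro fp_act_if_covering[of S ?Y]) simp_all
qed


section \<open>Right ideals of a Rees matrix monoid\<close>

text \<open>The indices i for which \<open>K\<close> meets the minimal right ideal R_i; the adjoined
  identity contributes none.\<close>

definition index_set :: "('i \<times> 'g \<times> 'l) option set \<Rightarrow> 'i set"
  where "index_set K = {i. \<exists>a l. Some (i, a, l) \<in> K}"

lemma finite_index_set: "finite K \<Longrightarrow> finite (index_set K)"
  by (rule finite_subset[of _ "(fst \<circ> the) ` K"]) (force simp: index_set_def)+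

section \<open>The Rees matrix monoid and its regularity\<close>

locale rees_matrix = group G for G :: "('g, 'm) monoid_scheme" (structure) +
  fixes I :: "'i set" and \<Lambda> :: "'l set" and P :: "'l \<Rightarrow> 'i \<Rightarrow> 'g"
  assumes I_nonempty: "I \<noteq> {}" and \<Lambda>_nonempty: "\<Lambda> \<noteq> {}"
    and P_closed [simp]: "l \<in> \<Lambda> \<Longrightarrow> i \<in> I \<Longrightarrow> P l i \<in> carrier G"
begin

abbreviation S :: "('i \<times> 'g \<times> 'l) option monoid"
  where "S \<equiv> rees_matrix_monoid G I \<Lambda> P"

lemma carrier_S: "carrier S = insert None (Some ` (I \<times> carrier G \<times> \<Lambda>))"
  by (simp add: rees_matrix_monoid_def adjoin_identity_def rees_carrier_def)

lemma None_in_S [simp]: "None \<in> carrier S"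
  by (simp add: carrier_S)

lemma Some_in_S [simp]: "Some (i, a, l) \<in> carrier S \<longleftrightarrow> i \<in> I \<and> a \<in> carrier G \<and> l \<in> \<Lambda>"
  by (auto simp: carrier_S)

lemma S_cases:
  assumes "s \<in> carrier S"
  obtains "s = None" | i a l where "s = Some (i, a, l)" "i \<in> I" "a \<in> carrier G" "l \<in> \<Lambda>"
  using assms by (auto simp: carrier_S)

lemma one_S [simp]: "\<one>\<^bsub>S\<^esub> = None"
  by (simp add: rees_matrix_monoid_def adjoin_identity_def)

lemma mult_S [simp]:
  "None \<otimes>\<^bsub>S\<^esub> s = s"
  "s \<otimes>\<^bsub>S\<^esub> None = s"
  "Some (i, a, l) \<otimes>\<^bsub>S\<^esub> Some (j, b, k) = Some (i, a \<otimes> P l j \<otimes> b, k)"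
  by (simp_all add: rees_matrix_monoid_def adjoin_identity_def) (cases s; simp)

lemma monoid_S: "monoid S"
proof
  show "s \<otimes>\<^bsub>S\<^esub> t \<in> carrier S" if "s \<in> carrier S" "t \<in> carrier S" for s t
    using that by (elim S_cases) auto
  show "s \<otimes>\<^bsub>S\<^esub> t \<otimes>\<^bsub>S\<^esub> u = s \<otimes>\<^bsub>S\<^esub> (t \<otimes>\<^bsub>S\<^esub> u)"
    if "s \<in> carrier S" "t \<in> carrier S" "u \<in> carrier S" for s t u
    using that by (elim S_cases) (simp_all add: m_assoc)
qed simp_all

lemma regular_monoid_S: "regular_monoid S"
  unfolding regular_monoid_def
proof (intro conjI ballI)
  fix s assume "s \<in> carrier S"
  then show "\<exists>t\<in>carrier S. s = s \<otimes>\<^bsub>S\<^esub> t \<otimes>\<^bsub>S\<^esub> s"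
  proof (cases rule: S_cases)
    case 1
    then show ?thesis by (intro bexI[of _ None]) simp_all
  next
    case (2 i a l)
    let ?p = "P l i"
    have p: "?p \<in> carrier G" using 2 by simp
    \<comment> \<open>The two inner factors \<open>inv ?p\<close> cancel the sandwich entries that
      multiplication inserts on either side of the witness.\<close>
    have "a \<otimes> ?p \<otimes> (inv ?p \<otimes> inv a \<otimes> inv ?p) \<otimes> ?p \<otimes> a = a \<otimes> (?p \<otimes> inv ?p) \<otimes> inv a \<otimes> (inv ?p \<otimes> ?p) \<otimes> a"
      using 2(3) p by (simp add: m_assoc)
    also have "\<dots> = a" using 2(3) p by simp
    finally show ?thesis
      using 2 p by (intro bexI[of _ "Some (i, inv ?p \<otimes> inv a \<otimes> inv ?p, l)"]) simp_all
  qed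
qed (rule monoid_S)

section \<open>Right ideals and the indices they meet\<close>

text \<open>This is the minimality of R_i. A multiplier with first index \<open>i\<close> inserts
  the entry \<open>P l i\<close>, and an equation in a group can be solved for the remaining
  factor.\<close>

lemma right_ideal_change_entries:
  assumes "right_ideal S K" "Some (i, a, l) \<in> K" "b \<in> carrier G" "k \<in> \<Lambda>"
  shows "Some (i, b, k) \<in> K"
proof -
  have *: "i \<in> I" "a \<in> carrier G" "l \<in> \<Lambda>"
    using assms(1,2) by (auto simp: right_ideal_def)
  let ?c = "a \<otimes> P l i"
  have c: "?c \<in> carrier G" using * by simp
  have "Some (i, inv ?c \<otimes> b, k) \<in> carrier S" using assms(3,4) c * by simp
  then have "Some (i, a, l) \<otimes>\<^bsub>S\<^esub> Some (i, inv ?c \<otimes> b, k) \<in> K"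
    using assms(1,2) unfolding right_ideal_def by blast
  moreover have "?c \<otimes> (inv ?c \<otimes> b) = b"
    using c assms(3) by (simp flip: m_assoc)
  ultimately show ?thesis by simp
qed

text \<open>Right multiplication preserves the first index, and the other two entries can be
  restored inside the ideal.\<close>

lemma right_ideal_factor:
  assumes "right_ideal S K" "Some (i, a, l) \<in> carrier S" "t \<in> carrier S"
    "Some (i, a, l) \<otimes>\<^bsub>S\<^esub> t \<in> K"
  shows "Some (i, a, l) \<in> K"
  using assms(3)
proof (cases rule: S_cases)
  case 1
  then show ?thesis using assms(4) by simp
next
  case (2 j b k)
  then show ?thesis using assms right_ideal_change_entries[OF assms(1)] by auto
qed

lemma right_ideal_None: "right_ideal S K \<Longrightarrow> None \<in> K \<Longrightarrow> K = carrier S"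
  unfolding right_ideal_def by (metis mult_S(1) subsetI subset_antisym)

text \<open>Multiples of a non-identity generator keep its first index, so finitely many generators
  reach finitely many indices. Conversely, one element of each R_i that is met generates all of that
  R_i, and the identity alone generates \<open>S\<close>.\<close>

lemma fg_right_ideal_iff:
  assumes K: "right_ideal S K"
  shows "fg_right_ideal S K \<longleftrightarrow> None \<in> K \<or> finite (index_set K)"
proof
  assume "fg_right_ideal S K"
  then obtain F where F: "finite F" "F \<subseteq> K" "K = (\<Union>a\<in>F. a <#\<^bsub>S\<^esub> carrier S)"
    unfolding fg_right_ideal_def by blast
  show "None \<in> K \<or> finite (index_set K)"
  proof (cases "None \<in> K")
    case False
    have "index_set K \<subseteq> index_set F"
    proof
      fix i assume "i \<in> index_set K"
      then obtain a l where "Some (i, a, l) \<in> K" by (auto simp: index_set_def)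
      then obtain f s where fs: "f \<in> F" "s \<in> carrier S" "Some (i, a, l) = f \<otimes>\<^bsub>S\<^esub> s"
        using F(3) by (auto simp: l_coset_def)
      then obtain j b k where f: "f = Some (j, b, k)"
        using False F(2) by (cases f) auto
      then have "j = i" using fs by (cases s) auto
      then show "i \<in> index_set F" using fs f by (auto simp: index_set_def)
    qed
    then show ?thesis using finite_index_set[OF F(1)] finite_subset by blast
  qed simp
next
  obtain l0 where l0: "l0 \<in> \<Lambda>" using \<Lambda>_nonempty by blast
  assume assum: "None \<in> K \<or> finite (index_set K)"
  show "fg_right_ideal S K"
  proof (cases "None \<in> K")
    case True
    then have "K = (\<Union>a\<in>{None}. a <#\<^bsub>S\<^esub> carrier S)"
      using right_ideal_None[OF K] by (auto simp: l_coset_def)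
    then show ?thesis
      using K True unfolding fg_right_ideal_def by (intro conjI exI[of _ "{None}"]) auto
  next
    case False
    then have fin: "finite (index_set K)" using assum by simp
    let ?F = "(\<lambda>i. Some (i, \<one>, l0)) ` index_set K"
    have FK: "?F \<subseteq> K"
      using right_ideal_change_entries[OF K] l0 by (auto simp: index_set_def)
    have "K = (\<Union>a\<in>?F. a <#\<^bsub>S\<^esub> carrier S)"
    proof
      show "(\<Union>a\<in>?F. a <#\<^bsub>S\<^esub> carrier S) \<subseteq> K"
        using FK K by (auto simp: l_coset_def right_ideal_def)
      show "K \<subseteq> (\<Union>a\<in>?F. a <#\<^bsub>S\<^esub> carrier S)"
      proof
        fix s assume s: "s \<in> K"
        then have "s \<in> carrier S" using K by (auto simp: right_ideal_def)
        then show "s \<in> (\<Union>a\<in>?F. a <#\<^bsub>S\<^esub> carrier S)"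
        proof (cases rule: S_cases)
          case 1
          then show ?thesis using False s by simp
        next
          case (2 i a l)
          \<comment> \<open>The factor \<open>inv (P l0 i)\<close> cancels the sandwich
            entry.\<close>
          have "Some (i, \<one>, l0) \<otimes>\<^bsub>S\<^esub> Some (i, inv (P l0 i) \<otimes> a, l) = s"
            using 2 l0 by (simp flip: m_assoc)
          moreover have "Some (i, inv (P l0 i) \<otimes> a, l) \<in> carrier S" using 2 l0 by simp
          moreover have "i \<in> index_set K" using s 2 by (auto simp: index_set_def)
          ultimately show ?thesis unfolding l_coset_def by blast
        qed
      qed
    qed
    then show ?thesis
      using K fin FK unfolding fg_right_ideal_def by (intro conjI exI[of _ ?F]) auto
  qed
qed

text \<open>Either both ideals contain the identity, or the finite index set of one of them bounds
  that of the intersection.\<close>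

lemma fg_right_ideal_Int:
  assumes "fg_right_ideal S K" "fg_right_ideal S L"
  shows "fg_right_ideal S (K \<inter> L)"
proof -
  have K: "right_ideal S K" and L: "right_ideal S L"
    using assms by (simp_all add: fg_right_ideal_def)
  then have KL: "right_ideal S (K \<inter> L)" by (auto simp: right_ideal_def)
  have "index_set (K \<inter> L) \<subseteq> index_set K" "index_set (K \<inter> L) \<subseteq> index_set L"
    by (auto simp: index_set_def)
  then have "finite (index_set K) \<or> finite (index_set L) \<Longrightarrow> finite (index_set (K \<inter> L))"
    using finite_subset by blast
  then show ?thesis
    using assms by (auto simp: fg_right_ideal_iff K L KL)
qed

lemma fg_right_ideal_principal:
  assumes "a \<in> carrier S"
  shows "fg_right_ideal S (a <#\<^bsub>S\<^esub> carrier S)"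
proof -
  interpret S: monoid S by (rule monoid_S)
  have "a \<in> a <#\<^bsub>S\<^esub> carrier S"
    using assms by (force simp: l_coset_def intro: bexI[of _ None])
  moreover have "right_ideal S (a <#\<^bsub>S\<^esub> carrier S)"
    using assms by (auto simp: right_ideal_def l_coset_def S.m_assoc intro!: bexI[of _ "_ \<otimes>\<^bsub>S\<^esub> _"])
  ultimately show ?thesis
    unfolding fg_right_ideal_def by (intro conjI exI[of _ "{a}"]) auto
qed

text \<open>For a non-identity \<open>x\<close>, a single product of \<open>x\<close> lying in
  \<open>K\<close> forces \<open>x\<close> itself into \<open>K\<close>, so the residual is empty or
  contains the identity.\<close>

lemma fg_right_ideal_residual:
  assumes K: "fg_right_ideal S K" and x: "x \<in> carrier S"
  shows "fg_right_ideal S (residual S K x)"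
proof -
  interpret S: monoid S by (rule monoid_S)
  have rK: "right_ideal S K" using K by (simp add: fg_right_ideal_def)
  then have r: "right_ideal S (residual S K x)"
    using x by (auto simp: right_ideal_def residual_def simp flip: S.m_assoc)
  show ?thesis
    using x
  proof (cases rule: S_cases)
    case 1
    then have "residual S K x = K" using rK by (auto simp: residual_def right_ideal_def)
    then show ?thesis using K by simp
  next
    case (2 i a l)
    then have "None \<in> residual S K x \<or> residual S K x = {}"
      using right_ideal_factor[OF rK, of i a l] x by (auto simp: residual_def)
    then show ?thesis using fg_right_ideal_iff[OF r] by (auto simp: index_set_def)
  qed
qed

text \<open>The non-identity elements form a right ideal meeting every R_i, which is finitely
  generated only for finite \<open>I\<close>. Conversely, every index set lies in
  \<open>I\<close>.\<close>

lemma weakly_right_noetherian_S_iff: "weakly_right_noetherian S \<longleftrightarrow> finite I"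
proof
  assume w: "weakly_right_noetherian S"
  let ?K = "Some ` (I \<times> carrier G \<times> \<Lambda>)"
  have K: "right_ideal S ?K"
    unfolding right_ideal_def carrier_S by auto
  have "index_set ?K = I" using \<Lambda>_nonempty by (auto simp: index_set_def image_iff)
  then show "finite I"
    using w fg_right_ideal_iff[OF K] K by (auto simp: weakly_right_noetherian_def)
next
  assume fin: "finite I"
  have "finite (index_set K)" if "right_ideal S K" for K
    using that by (intro finite_subset[OF _ fin]) (auto simp: index_set_def right_ideal_def)
  then show "weakly_right_noetherian S"
    by (simp add: weakly_right_noetherian_def fg_right_ideal_iff)
qed

section \<open>Saturation by a finitely generated congruence\<close>

text \<open>If \<open>(x, 1)\<close> does not lie in the saturated subact \<open>U\<close>, then the elements \<open>(x, s)\<close> of \<open>U\<close>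
  have their indices among those occurring in the generators of \<open>\<rho>\<close> and of \<open>U\<close>.\<close>

lemma fg_right_ideal_saturated_component:
  fixes X :: "'x set"
  assumes \<rho>: "fg_act_congruence S (free_act S X) \<rho>"
    and F: "finite F" "F \<subseteq> X \<times> carrier S"
    and U: "U = {w. \<exists>b\<in>F. \<exists>t\<in>carrier S. (act (free_act S X) b t, w) \<in> \<rho>}"
  shows "fg_right_ideal S {s. (x, s) \<in> U}"
proof -
  interpret S: monoid S by (rule monoid_S)
  obtain H where finH: "finite H" and H\<rho>: "H \<subseteq> \<rho>"
    and Hmin: "\<And>\<sigma>. act_congruence S (free_act S X) \<sigma> \<Longrightarrow> H \<subseteq> \<sigma> \<Longrightarrow> \<rho> \<subseteq> \<sigma>"
    using \<rho> unfolding fg_act_congruence_def by blast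
  have cong: "act_congruence S (free_act S X) \<rho>" using \<rho> by (simp add: fg_act_congruence_def)
  have \<rho>sub: "\<rho> \<subseteq> (X \<times> carrier S) \<times> (X \<times> carrier S)"
    and refl: "\<And>w. w \<in> X \<times> carrier S \<Longrightarrow> (w, w) \<in> \<rho>"
    and sym: "\<And>u v. (u, v) \<in> \<rho> \<Longrightarrow> (v, u) \<in> \<rho>"
    and trans: "\<And>u v w. (u, v) \<in> \<rho> \<Longrightarrow> (v, w) \<in> \<rho> \<Longrightarrow> (u, w) \<in> \<rho>"
    and act_\<rho>: "\<And>u v s. (u, v) \<in> \<rho> \<Longrightarrow> s \<in> carrier S \<Longrightarrow>
      (act (free_act S X) u s, act (free_act S X) v s) \<in> \<rho>"
    using cong unfolding act_congruence_iff free_act_simps(1) by blast+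
  have act_act: "act (free_act S X) (act (free_act S X) w s) t = act (free_act S X) w (s \<otimes>\<^bsub>S\<^esub> t)"
    if "w \<in> X \<times> carrier S" "s \<in> carrier S" "t \<in> carrier S" for w s t
    using that by (auto simp: S.m_assoc)
  have Usub: "U \<subseteq> X \<times> carrier S" using \<rho>sub by (auto simp: U)
  have U_act: "act (free_act S X) w s \<in> U" if w: "w \<in> U" and s: "s \<in> carrier S" for w s
  proof -
    obtain b t where b: "b \<in> F" "t \<in> carrier S" "(act (free_act S X) b t, w) \<in> \<rho>"
      using w U by blast
    then have "(act (free_act S X) b (t \<otimes>\<^bsub>S\<^esub> s), act (free_act S X) w s) \<in> \<rho>"
      using act_\<rho>[OF b(3) s] act_act[of b t s] F(2) s by auto
    then show ?thesis using b s unfolding U by blast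
  qed
  have U_sat: "v \<in> U" if "(u, v) \<in> \<rho>" "u \<in> U" for u v
    using that trans unfolding U by blast
  have ideal: "right_ideal S {s. (y, s) \<in> U}" for y
    using Usub U_act by (fastforce simp: right_ideal_def)
  define J where "J = index_set (snd ` F \<union> (\<Union>(u, v)\<in>H. {snd u, snd v}))"
  have finJ: "finite J"
    unfolding J_def by (rule finite_index_set) (use F finH in auto)
  have J_generator: "i \<in> J" if "(y, Some (i, a, l)) \<in> F" for y i a l
    using image_eqI[OF _ that, of "Some (i, a, l)" snd] unfolding J_def index_set_def by auto
  have J_relation: "i \<in> J" if "(u, v) \<in> H" "snd u = Some (i, a, l) \<or> snd v = Some (i, a, l)" for u v i a l
  proof -
    have "Some (i, a, l) \<in> {snd u, snd v}" using that(2) by auto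
    then have "Some (i, a, l) \<in> (\<Union>(u, v)\<in>H. {snd u, snd v})"
      using UN_I[OF that(1), of "Some (i, a, l)" "\<lambda>(u, v). {snd u, snd v}"] by simp
    then show ?thesis unfolding J_def index_set_def by blast
  qed
  \<comment> \<open>\<open>V\<close> is the part of \<open>U\<close> obeying the desired bound; the
    goal is that nothing of \<open>U\<close> is lost.\<close>
  define V where "V = {(y, s) \<in> U. (y, None) \<in> U \<or> (\<exists>i\<in>J. \<exists>a l. s = Some (i, a, l))}"
  \<comment> \<open>The pairs of \<open>\<rho>\<close> that no right multiplier separates with
    respect to \<open>V\<close>. Once \<open>H\<close> is shown to lie in it, minimality makes
    \<open>V\<close> closed under \<open>\<rho>\<close>.\<close>
  define \<tau> where "\<tau> = {(u, v) \<in> \<rho>. \<forall>t\<in>carrier S.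
    act (free_act S X) u t \<in> V \<longleftrightarrow> act (free_act S X) v t \<in> V}"
  have "act_congruence S (free_act S X) \<tau>"
    unfolding act_congruence_iff
  proof (intro conjI allI impI ballI)
    show "\<tau> \<subseteq> carrier (free_act S X) \<times> carrier (free_act S X)"
      using \<rho>sub by (auto simp: \<tau>_def)
    show "(w, w) \<in> \<tau>" if "w \<in> carrier (free_act S X)" for w
      using that refl by (simp add: \<tau>_def)
    show "(v, u) \<in> \<tau>" if "(u, v) \<in> \<tau>" for u v
      using that sym by (simp add: \<tau>_def)
    show "(u, w) \<in> \<tau>" if "(u, v) \<in> \<tau>" "(v, w) \<in> \<tau>" for u v w
      using that trans[of u v w] by (simp add: \<tau>_def)
    show "(act (free_act S X) u s, act (free_act S X) v s) \<in> \<tau>"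
      if uv: "(u, v) \<in> \<tau>" and s: "s \<in> carrier S" for u v s
    proof -
      have "u \<in> X \<times> carrier S" "v \<in> X \<times> carrier S" using uv \<rho>sub by (auto simp: \<tau>_def)
      then show ?thesis using uv s act_\<rho> act_act by (simp add: \<tau>_def)
    qed
  qed
  moreover have "H \<subseteq> \<tau>"
  proof -
    \<comment> \<open>If \<open>s'\<close> is not 1, its index lies in \<open>J\<close> and survives
      multiplication. If only \<open>s'\<close> is 1, then \<open>s\<close> lies in its component of
      \<open>U\<close> by \<open>right_ideal_factor\<close>, and saturation brings in (y', 1). If
      both are 1, the bound passes over directly.\<close>
    have half: "act (free_act S X) (y', s') t \<in> V"
      if uv: "((y, s), (y', s')) \<in> \<rho>" and t: "t \<in> carrier S"
        and V: "act (free_act S X) (y, s) t \<in> V"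
        and J: "\<And>i a l. s = Some (i, a, l) \<Longrightarrow> i \<in> J" "\<And>i a l. s' = Some (i, a, l) \<Longrightarrow> i \<in> J"
      for y s y' s' t
    proof -
      have S: "s \<in> carrier S" "s' \<in> carrier S" using uv \<rho>sub by auto
      have stU: "(y, s \<otimes>\<^bsub>S\<^esub> t) \<in> U" using V by (simp add: V_def)
      then have U': "(y', s' \<otimes>\<^bsub>S\<^esub> t) \<in> U"
        using U_sat act_\<rho>[OF uv t] by simp
      have "(y', None) \<in> U \<or> (\<exists>i\<in>J. \<exists>a l. s' \<otimes>\<^bsub>S\<^esub> t = Some (i, a, l))"
      proof (cases s')
        case (Some r)
        then show ?thesis using J(2) t by (cases r; cases t) auto
      next
        case None
        show ?thesis
        proof (cases s)
          case (Some r)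
          then have "(y, s) \<in> U"
            using right_ideal_factor[OF ideal[of y], of _ _ _ t] S t stU by (cases r) auto
          then show ?thesis using U_sat uv None by blast
        next
          case s: None
          have "(y, None) \<in> U \<longrightarrow> (y', None) \<in> U" using U_sat uv None s by blast
          then show ?thesis using V None s by (auto simp: V_def)
        qed
      qed
      then show ?thesis using U' by (simp add: V_def)
    qed
    show ?thesis
    proof clarify
      fix y s y' s' assume H: "((y, s), (y', s')) \<in> H"
      have J: "i \<in> J" if "s = Some (i, a, l) \<or> s' = Some (i, a, l)" for i a l
        using that J_relation[OF H] by simp
      have "((y, s), (y', s')) \<in> \<rho>" "((y', s'), (y, s)) \<in> \<rho>" using H H\<rho> sym by blast+
      then show "((y, s), (y', s')) \<in> \<tau>"
        using half J unfolding \<tau>_def by blast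
    qed
  qed
  ultimately have \<tau>: "\<rho> \<subseteq> \<tau>" by (rule Hmin)
  have "U \<subseteq> V"
  proof
    fix w assume "w \<in> U"
    then obtain b t where b: "b \<in> F" "t \<in> carrier S" "(act (free_act S X) b t, w) \<in> \<rho>"
      using U by blast
    obtain y s where ys: "b = (y, s)" by fastforce
    have s: "y \<in> X" "s \<in> carrier S" using b F(2) ys by auto
    have ysU: "(y, s) \<in> U"
      using b(1) refl[of "(y, s)"] s ys unfolding U by (force intro!: bexI[of _ b] bexI[of _ None])
    then have "act (free_act S X) b t \<in> U"
      using U_act[of "(y, s)" t] b(2) ys by blast
    moreover have "i \<in> J" if "s = Some (i, a, l)" for i a l
      using that b(1) ys J_generator by blast
    ultimately have "act (free_act S X) b t \<in> V"
      using ysU unfolding V_def ys by (cases s; cases t) auto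
    moreover have "w \<in> X \<times> carrier S" using \<open>w \<in> U\<close> Usub by blast
    \<comment> \<open>The condition of \<open>\<tau>\<close> at \<open>t\<close> = 1 carries
      membership in \<open>V\<close> over to \<open>w\<close>.\<close>
    moreover have "(act (free_act S X) b t, w) \<in> \<tau>" using \<tau> b(3) by blast
    ultimately show "w \<in> V"
      using s b(2) unfolding \<tau>_def ys by (auto dest!: bspec[of _ _ None])
  qed
  then have "None \<in> {s. (x, s) \<in> U} \<or> index_set {s. (x, s) \<in> U} \<subseteq> J"
    by (auto simp: V_def index_set_def)
  then show ?thesis
    using fg_right_ideal_iff[OF ideal] finJ finite_subset by blast
qed

text \<open>A right congruence on \<open>S\<close> is a congruence on the free act with one
  generator, so the result for components applies with \<open>X\<close> a singleton.\<close>

lemma fg_right_ideal_saturation: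
  assumes \<rho>: "fg_right_congruence S \<rho>" and a: "a \<in> carrier S"
  shows "fg_right_ideal S (saturation S (a <#\<^bsub>S\<^esub> carrier S) \<rho>)"
proof -
  let ?F = "free_act S {()}"
  let ?lift = "\<lambda>\<sigma>. {(((), s), ((), t)) | s t. (s, t) \<in> \<sigma>}"
  have cong_iff: "act_congruence S ?F \<sigma> \<longleftrightarrow> right_congruence S {(s, t). (((), s), ((), t)) \<in> \<sigma>}" for \<sigma>
    unfolding act_congruence_iff right_congruence_def equiv_def refl_on_def sym_def trans_def
    by auto
  have cong: "right_congruence S \<rho>" using \<rho> by (simp add: fg_right_congruence_def)
  then have eq: "equiv (carrier S) \<rho>" by (simp add: right_congruence_def)
  obtain H where H: "finite H" "H \<subseteq> carrier S \<times> carrier S" "H \<subseteq> \<rho>"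
    and Hmin: "\<And>\<sigma>. right_congruence S \<sigma> \<Longrightarrow> H \<subseteq> \<sigma> \<Longrightarrow> \<rho> \<subseteq> \<sigma>"
    using \<rho> unfolding fg_right_congruence_def by blast
  have "?lift \<rho> \<subseteq> \<sigma>" if "act_congruence S ?F \<sigma>" "?lift H \<subseteq> \<sigma>" for \<sigma>
    using Hmin[of "{(s, t). (((), s), ((), t)) \<in> \<sigma>}"] that unfolding cong_iff by blast
  moreover have "?lift H = (\<lambda>(s, t). (((), s), ((), t))) ` H" by auto
  ultimately have "fg_act_congruence S ?F (?lift \<rho>)"
    using H cong unfolding fg_act_congruence_def
    by (intro conjI exI[of _ "?lift H"]) (auto simp: cong_iff)
  from fg_right_ideal_saturated_component[OF this, of "{((), a)}" _ "()"] a
  have "fg_right_ideal S {s. \<exists>t\<in>carrier S. (a \<otimes>\<^bsub>S\<^esub> t, s) \<in> \<rho>}"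
    by simp
  moreover have "{s. \<exists>t\<in>carrier S. (a \<otimes>\<^bsub>S\<^esub> t, s) \<in> \<rho>} = saturation S (a <#\<^bsub>S\<^esub> carrier S) \<rho>"
    using eq unfolding saturation_def l_coset_def equiv_def sym_def by blast
  ultimately show ?thesis by simp
qed

section \<open>Idempotent generators and coherence\<close>

text \<open>Each R_i has an idempotent acting on it as a left identity. Left multiplication by that
  idempotent maps every non-identity element into R_i, so it fixes none outside R_i; hence
  uniqueness. If the identity lies in \<open>K\<close>, it serves alone.\<close>

lemma idempotent_generators:
  assumes K: "fg_right_ideal S K"
  shows "\<exists>E. finite E \<and> E \<subseteq> K \<and> (\<forall>e\<in>E. e \<otimes>\<^bsub>S\<^esub> e = e) \<and>
    (\<forall>u\<in>K. \<exists>!e. e \<in> E \<and> e \<otimes>\<^bsub>S\<^esub> u = u)"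
proof (cases "None \<in> K")
  case True
  then show ?thesis by (intro exI[of _ "{None}"]) auto
next
  case False
  have rK: "right_ideal S K" using K by (simp add: fg_right_ideal_def)
  then have KS: "K \<subseteq> carrier S" by (simp add: right_ideal_def)
  have fin: "finite (index_set K)" using fg_right_ideal_iff[OF rK] K False by simp
  obtain l0 where l0: "l0 \<in> \<Lambda>" using \<Lambda>_nonempty by blast
  define \<epsilon> where "\<epsilon> i = Some (i, inv (P l0 i), l0)" for i
  have index: "i \<in> I \<and> \<epsilon> i \<in> K" if i: "i \<in> index_set K" for i
  proof -
    obtain a l where "Some (i, a, l) \<in> K" using i by (auto simp: index_set_def)
    moreover from this have "i \<in> I" using KS by auto
    ultimately show ?thesis using right_ideal_change_entries[OF rK] l0 by (simp add: \<epsilon>_def)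
  qed
  have left: "\<epsilon> i \<otimes>\<^bsub>S\<^esub> Some (j, b, k) = Some (j, b, k) \<longleftrightarrow> i = j"
    if "i \<in> I" "b \<in> carrier G" for i j b k
    using that l0 by (auto simp: \<epsilon>_def)
  show ?thesis
  proof (intro exI[of _ "\<epsilon> ` index_set K"] conjI ballI)
    show "e \<otimes>\<^bsub>S\<^esub> e = e" if "e \<in> \<epsilon> ` index_set K" for e
      using that index l0 by (auto simp: \<epsilon>_def)
    show "\<exists>!e. e \<in> \<epsilon> ` index_set K \<and> e \<otimes>\<^bsub>S\<^esub> u = u" if u: "u \<in> K" for u
    proof -
      have "u \<in> carrier S" using u KS by blast
      then obtain j b k where j: "u = Some (j, b, k)" "b \<in> carrier G"
        using u False by (elim S_cases) auto
      then have "j \<in> index_set K" using u by (auto simp: index_set_def)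
      then show ?thesis
        using left[OF _ j(2)] index unfolding j(1) by (intro ex1I[of _ "\<epsilon> j"]) auto
    qed
  qed (use fin index in auto)
qed

lemma right_coherent_S: "right_coherent S TYPE('c)"
  unfolding right_coherent_def
proof (intro allI impI)
  fix A :: "('c, ('i \<times> 'g \<times> 'l) option) ract" and B
  assume act: "right_act S A" and fp: "fp_act S A" and sub: "subact S A B"
    and fgB: "fg_act S (A\<lparr>carrier := B\<rparr>)"
  obtain X :: "nat set" and q where finX: "finite X" and cov: "covering S A X q"
    and fg: "fg_act_congruence S (free_act S X) (act_kernel S X q)"
    using fp_act_obtains_covering[OF monoid_S act fp] .
  obtain F where F: "finite F" "F \<subseteq> B" "B = (\<Union>b\<in>F. act A b ` carrier S)"
    using fgB by (auto simp: fg_act_def)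
  \<comment> \<open>The generators of \<open>B\<close> are lifted to a finite subset
    \<open>W\<close> of the free act.\<close>
  have "F \<subseteq> q ` (X \<times> carrier S)" using F(2) sub cov by (auto simp: subact_def covering_def)
  then obtain W where W: "finite W" "W \<subseteq> X \<times> carrier S" "F = q ` W"
    using finite_subset_image[OF F(1)] by metis
  define K where "K x = {s \<in> carrier S. q (x, s) \<in> B}" for x
  have K: "fg_right_ideal S (K x)" if x: "x \<in> X" for x
  proof -
    interpret S: monoid S by (rule monoid_S)
    have w: "q (act (free_act S X) w t) = act A (q w) t" "act (free_act S X) w t \<in> X \<times> carrier S"
      if "w \<in> W" "t \<in> carrier S" for w t
      using that W(2) cov by (auto simp: covering_def)
    \<comment> \<open>The preimage of \<open>B\<close> is the saturation, by the kernel of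
      \<open>q\<close>, of the subact generated by \<open>W\<close>, so \<open>K x\<close> is one of
      its components.\<close>
    have "s \<in> K x \<longleftrightarrow> (\<exists>b\<in>W. \<exists>t\<in>carrier S. (act (free_act S X) b t, (x, s)) \<in> act_kernel S X q)" for s
    proof -
      have B: "z \<in> B \<longleftrightarrow> (\<exists>b\<in>W. \<exists>t\<in>carrier S. act A (q b) t = z)" for z
        unfolding F(3) W(3) by blast
      have "(act (free_act S X) b t, (x, s)) \<in> act_kernel S X q \<longleftrightarrow>
          s \<in> carrier S \<and> act A (q b) t = q (x, s)" if "b \<in> W" "t \<in> carrier S" for b t
        using w[OF that] x by (simp add: act_kernel_def)
      then show ?thesis unfolding K_def B mem_Collect_eq by blast
    qed
    then have "K x = {s. (x, s) \<in>
        {w. \<exists>b\<in>W. \<exists>t\<in>carrier S. (act (free_act S X) b t, w) \<in> act_kernel S X q}}"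
      by blast
    then show ?thesis
      using fg_right_ideal_saturated_component[OF fg W(1,2) refl, of x] by simp
  qed
  have "\<exists>E. finite E \<and> E \<subseteq> K x \<and> (\<forall>e\<in>E. e \<otimes>\<^bsub>S\<^esub> e = e) \<and>
      (\<forall>u\<in>K x. \<exists>!e. e \<in> E \<and> e \<otimes>\<^bsub>S\<^esub> u = u)" if "x \<in> X" for x
    by (rule idempotent_generators[OF K[OF that]])
  then have "\<exists>E. \<forall>x\<in>X. finite (E x) \<and> E x \<subseteq> K x \<and> (\<forall>e\<in>E x. e \<otimes>\<^bsub>S\<^esub> e = e) \<and>
      (\<forall>u\<in>K x. \<exists>!e. e \<in> E x \<and> e \<otimes>\<^bsub>S\<^esub> u = u)"
    by (intro bchoice ballI)
  then obtain E where E: "\<forall>x\<in>X. finite (E x) \<and> E x \<subseteq> K x \<and> (\<forall>e\<in>E x. e \<otimes>\<^bsub>S\<^esub> e = e) \<and>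
      (\<forall>u\<in>K x. \<exists>!e. e \<in> E x \<and> e \<otimes>\<^bsub>S\<^esub> u = u)" ..
  show "fp_act S (A\<lparr>carrier := B\<rparr>)"
    by (rule fp_subact_if_idempotent_generated[OF monoid_S finX cov fg act sub K_def, where E = E])
      (use E fg_right_ideal_residual[OF K] in blast)+
qed

end

theorem proposition3p5:
  fixes G :: "('g, 'm) monoid_scheme"
    and I :: "'i set" and \<Lambda> :: "'l set"
    and P :: "'l \<Rightarrow> 'i \<Rightarrow> 'g"
  assumes "group G"
    and "I \<noteq> {}" and "\<Lambda> \<noteq> {}"
    and "\<And>l i. l \<in> \<Lambda> \<Longrightarrow> i \<in> I \<Longrightarrow> P l i \<in> carrier G"
  shows "let S = rees_matrix_monoid G I \<Lambda> P in
    regular_monoid S \<and>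
    (\<forall>\<rho>. fg_right_congruence S \<rho> \<longrightarrow>
      (\<forall>a\<in>carrier S. \<forall>b\<in>carrier S. \<forall>x\<in>carrier S. \<forall>y\<in>carrier S.
        fg_right_ideal S
          (saturation S (a <#\<^bsub>S\<^esub> carrier S) \<rho> \<inter> saturation S (b <#\<^bsub>S\<^esub> carrier S) \<rho>) \<and>
        fg_right_ideal S
          (residual S (a <#\<^bsub>S\<^esub> carrier S) x \<inter> residual S (b <#\<^bsub>S\<^esub> carrier S) y))) \<and>
    right_coherent S TYPE('c) \<and>
    (weakly_right_noetherian S \<longleftrightarrow> finite I)"
proof -
  interpret rees_matrix G I \<Lambda> P
    using assms by (simp add: rees_matrix_def rees_matrix_axioms_def)
  show ?thesis
    unfolding Let_def
    using regular_monoid_S right_coherent_S weakly_right_noetherian_S_iff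
    by (auto intro!: fg_right_ideal_Int fg_right_ideal_saturation fg_right_ideal_residual
        fg_right_ideal_principal)
qed

end
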